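(* For every positive integer $d$, the forgetful functor $\Phi\colon\mathbf{OI}_d\to\mathbf{FI}_d$ satisfies property (F). In particular, $\mathbf{FI}_d$ is quasi-Gröbner.
   Context: $\mathbf{FI}_d$ is the category whose objects are finite sets; a morphism $S\to T$ is a pair $(f,g)$ with $f\colon S\to T$ an injection and $g\colon T\setminus f(S)\to\{1,\dots,d\}$ a function. The composite of $(f,g)\colon S\to T$ and $(f',g')\colon T\to U$ is $(f'f,g'')$ where $g''=g'$ on $U\setminus f'(T)$ and $g''(f'(t))=g(t)$ for $t\in T\setminus f(S)$. $\mathbf{OI}_d$ has totally ordered finite sets as objects, and a morphism $S\to T$ is a pair $(f,g)$ with $f\colon S\to T$ an order-preserving injection and $g\colon T\setminus f(S)\to\{1,\dots,d\}$ an arbitrary function, with composition given by the same formula as in $\mathbf{FI}_d$. The forgetful functor forgets the orders. A functor $\Phi\colon\mathcal{C}'\to\mathcal{C}$ satisfies property (F) if for every object $x$ of $\mathcal{C}$ there exist finitely many objects $y_1,\dots,y_n$ of $\mathcal{C}'$ and morphisms $f_i\colon x\to\Phi(y_i)$ such that for every object $y$ of $\mathcal{C}'$ and every morphism $f\colon x\to\Phi(y)$ there exist $i$ and $g\colon y_i\to y$ in $\mathcal{C}'$ with $f=\Phi(g)\circ f_i$. For an essentially small category $\mathcal{C}$ and object $x$, let $S_x(y)=\mathrm{Hom}(x,y)$. $\mathcal{C}$ is Gröbner if for every object $x$: (1) there are well-orders on all the sets $S_x(y)$ such that every postcomposition map $S_x(y)\to S_x(z)$ is strictly order-preserving; and (2)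 the poset $|S_x|$ is noetherian, i.e. every infinite sequence $x_1,x_2,\dots$ in it has $i<j$ with $x_i\le x_j$. Here $|S_x|$ is the quotient of the collection of all morphisms out of $x$, preordered by $f\le g$ iff $g=hf$ for some $h$, by the equivalence relation $f\le g\le f$. $\mathcal{C}$ is quasi-Gröbner if there exist a Gröbner category $\mathcal{C}'$ and an essentially surjective functor $\mathcal{C}'\to\mathcal{C}$ satisfying property (F). *)

theory Defs
  imports "HOL-Library.FuncSet"
begin

section \<open>Categories and functors\<close>

text \<open>
  Every arrow carries its source and target, so the hom-sets are pairwise disjoint.
  \<open>Comp C g f\<close> is the composite ``g after f''; it is only constrained when
  \<open>Cod C f = Dom C g\<close>. Objects and arrows form sets over HOL types, so every such
  category is small, and in particular essentially small.
\<close>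

record ('o, 'm) cat =
  Obj :: "'o set"
  Arr :: "'m set"
  Dom :: "'m \<Rightarrow> 'o"
  Cod :: "'m \<Rightarrow> 'o"
  Ident :: "'o \<Rightarrow> 'm"
  Comp :: "'m \<Rightarrow> 'm \<Rightarrow> 'm"

definition hom :: "('o, 'm) cat \<Rightarrow> 'o \<Rightarrow> 'o \<Rightarrow> 'm set" where
  "hom C x y = {f \<in> Arr C. Dom C f = x \<and> Cod C f = y}"

locale category =
  fixes C :: "('o, 'm) cat"
  assumes dom_closed: "f \<in> Arr C \<Longrightarrow> Dom C f \<in> Obj C"
    and cod_closed: "f \<in> Arr C \<Longrightarrow> Cod C f \<in> Obj C"
    and ident_closed: "x \<in> Obj C \<Longrightarrow> Ident C x \<in> hom C x x"
    and comp_closed: "f \<in> hom C x y \<Longrightarrow> g \<in> hom C y z \<Longrightarrow> Comp C g f \<in> hom C x z"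
    and comp_assoc: "f \<in> hom C w x \<Longrightarrow> g \<in> hom C x y \<Longrightarrow> h \<in> hom C y z \<Longrightarrow>
      Comp C h (Comp C g f) = Comp C (Comp C h g) f"
    and comp_ident_right: "f \<in> hom C x y \<Longrightarrow> Comp C f (Ident C x) = f"
    and comp_ident_left: "f \<in> hom C x y \<Longrightarrow> Comp C (Ident C y) f = f"

definition isomorphic :: "('o, 'm) cat \<Rightarrow> 'o \<Rightarrow> 'o \<Rightarrow> bool" where
  "isomorphic C x y \<longleftrightarrow>
    (\<exists>f \<in> hom C x y. \<exists>g \<in> hom C y x. Comp C g f = Ident C x \<and> Comp C f g = Ident C y)"

record ('o1, 'm1, 'o2, 'm2) functor_data =
  FObj :: "'o1 \<Rightarrow> 'o2"
  FArr :: "'m1 \<Rightarrow> 'm2"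

locale cat_functor = source: category C' + target: category C
  for C' :: "('o1, 'm1) cat" and C :: "('o2, 'm2) cat" +
  fixes \<Phi> :: "('o1, 'm1, 'o2, 'm2) functor_data"
  assumes obj_closed: "x \<in> Obj C' \<Longrightarrow> FObj \<Phi> x \<in> Obj C"
    and arr_closed: "f \<in> hom C' x y \<Longrightarrow> FArr \<Phi> f \<in> hom C (FObj \<Phi> x) (FObj \<Phi> y)"
    and preserves_ident: "x \<in> Obj C' \<Longrightarrow> FArr \<Phi> (Ident C' x) = Ident C (FObj \<Phi> x)"
    and preserves_comp: "f \<in> hom C' x y \<Longrightarrow> g \<in> hom C' y z \<Longrightarrow>
      FArr \<Phi> (Comp C' g f) = Comp C (FArr \<Phi> g) (FArr \<Phi> f)"

definition essentially_surjective ::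
    "('o1, 'm1) cat \<Rightarrow> ('o2, 'm2) cat \<Rightarrow> ('o1, 'm1, 'o2, 'm2) functor_data \<Rightarrow> bool" where
  "essentially_surjective C' C \<Phi> \<longleftrightarrow>
    cat_functor C' C \<Phi> \<and> (\<forall>x \<in> Obj C. \<exists>y \<in> Obj C'. isomorphic C (FObj \<Phi> y) x)"

definition property_F ::
    "('o1, 'm1) cat \<Rightarrow> ('o2, 'm2) cat \<Rightarrow> ('o1, 'm1, 'o2, 'm2) functor_data \<Rightarrow> bool" where
  "property_F C' C \<Phi> \<longleftrightarrow>
    cat_functor C' C \<Phi> \<and>
    (\<forall>x \<in> Obj C. \<exists>(n::nat) (y :: nat \<Rightarrow> 'o1) (f :: nat \<Rightarrow> 'm2).
      (\<forall>i \<in> {1..n}. y i \<in> Obj C' \<and> f i \<in> hom C x (FObj \<Phi> (y i))) \<and>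
      (\<forall>z \<in> Obj C'. \<forall>h \<in> hom C x (FObj \<Phi> z).
        \<exists>i \<in> {1..n}. \<exists>g \<in> hom C' (y i) z. h = Comp C (FArr \<Phi> g) (f i)))"


section \<open>Groebner and quasi-Groebner categories\<close>

definition arrows_from :: "('o, 'm) cat \<Rightarrow> 'o \<Rightarrow> 'm set" where
  "arrows_from C x = {f \<in> Arr C. Dom C f = x}"

definition arrow_le :: "('o, 'm) cat \<Rightarrow> 'm \<Rightarrow> 'm \<Rightarrow> bool" where
  "arrow_le C f g \<longleftrightarrow> (\<exists>h \<in> hom C (Cod C f) (Cod C g). g = Comp C h f)"

definition arrow_equiv :: "('o, 'm) cat \<Rightarrow> 'o \<Rightarrow> 'm rel" where
  "arrow_equiv C x = {(f, g). f \<in> arrows_from C x \<and> g \<in> arrows_from C x \<and>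
    arrow_le C f g \<and> arrow_le C g f}"

text \<open>The poset \<open>|S_x|\<close>: its elements, and the order induced on equivalence classes.\<close>

definition arrow_classes :: "('o, 'm) cat \<Rightarrow> 'o \<Rightarrow> 'm set set" where
  "arrow_classes C x = arrows_from C x // arrow_equiv C x"

definition class_le :: "('o, 'm) cat \<Rightarrow> 'm set \<Rightarrow> 'm set \<Rightarrow> bool" where
  "class_le C A B \<longleftrightarrow> (\<exists>f \<in> A. \<exists>g \<in> B. arrow_le C f g)"

definition noetherian_poset :: "'p set \<Rightarrow> ('p \<Rightarrow> 'p \<Rightarrow> bool) \<Rightarrow> bool" where
  "noetherian_poset P le \<longleftrightarrow>
    (\<forall>s :: nat \<Rightarrow> 'p. (\<forall>i. s i \<in> P) \<longrightarrow> (\<exists>i j. i < j \<and> le (s i) (s j)))"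

text \<open>Well-orders are reflexive relations here, hence the explicit \<open>f \<noteq> g\<close>.\<close>

definition compatible_well_orders :: "('o, 'm) cat \<Rightarrow> 'o \<Rightarrow> ('o \<Rightarrow> 'm rel) \<Rightarrow> bool" where
  "compatible_well_orders C x R \<longleftrightarrow>
    (\<forall>y \<in> Obj C. well_order_on (hom C x y) (R y)) \<and>
    (\<forall>y \<in> Obj C. \<forall>z \<in> Obj C. \<forall>h \<in> hom C y z. \<forall>f \<in> hom C x y. \<forall>g \<in> hom C x y.
      (f, g) \<in> R y \<and> f \<noteq> g \<longrightarrow> (Comp C h f, Comp C h g) \<in> R z \<and> Comp C h f \<noteq> Comp C h g)"

definition groebner :: "('o, 'm) cat \<Rightarrow> bool" where
  "groebner C \<longleftrightarrow> category C \<and>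
    (\<forall>x \<in> Obj C. (\<exists>R. compatible_well_orders C x R) \<and>
      noetherian_poset (arrow_classes C x) (class_le C))"

text \<open>
  HOL cannot quantify existentially over types, so the types of objects and arrows in which
  the Groebner category is sought are a parameter. For any choice of these types the
  predicate implies the existence of a Groebner category as required.
\<close>

definition quasi_groebner :: "('o1 \<times> 'm1) itself \<Rightarrow> ('o2, 'm2) cat \<Rightarrow> bool" where
  "quasi_groebner (_ :: ('o1 \<times> 'm1) itself) C \<longleftrightarrow>
    (\<exists>(C' :: ('o1, 'm1) cat) \<Phi>.
      groebner C' \<and> essentially_surjective C' C \<Phi> \<and> property_F C' C \<Phi>)"


section \<open>Coloured injections of finite sets\<close>

text \<open>
  The pairs \<open>(f, g)\<close> with \<open>f : S \<rightarrow> T\<close> injective and \<open>g : T - f(S) \<rightarrow> {1..d}\<close>. Both functions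
  are extensional (\<open>undefined\<close> off their domain), so equality of HOL functions is equality of
  functions on the domain.
\<close>

definition coloured_injections ::
    "nat \<Rightarrow> 'a set \<Rightarrow> 'a set \<Rightarrow> (('a \<Rightarrow> 'a) \<times> ('a \<Rightarrow> nat)) set" where
  "coloured_injections d S T =
    {(f, g). f \<in> S \<rightarrow>\<^sub>E T \<and> inj_on f S \<and> g \<in> (T - f ` S) \<rightarrow>\<^sub>E {1..d}}"

definition compose_colouring ::
    "'a set \<Rightarrow> 'a set \<Rightarrow> 'a set \<Rightarrow> ('a \<Rightarrow> 'a) \<times> ('a \<Rightarrow> nat) \<Rightarrow> ('a \<Rightarrow> 'a) \<times> ('a \<Rightarrow> nat) \<Rightarrow> 'a \<Rightarrow> nat"
  where
  "compose_colouring S T U = (\<lambda>(f', g') (f, g).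
    \<lambda>u \<in> U - f' ` f ` S. if u \<in> f' ` T then g (the_inv_into T f' u) else g' u)"

definition compose_coloured ::
    "'a set \<Rightarrow> 'a set \<Rightarrow> 'a set \<Rightarrow> ('a \<Rightarrow> 'a) \<times> ('a \<Rightarrow> nat) \<Rightarrow> ('a \<Rightarrow> 'a) \<times> ('a \<Rightarrow> nat) \<Rightarrow>
      ('a \<Rightarrow> 'a) \<times> ('a \<Rightarrow> nat)" where
  "compose_coloured S T U p' p =
    (compose S (fst p') (fst p), compose_colouring S T U p' p)"

definition identity_coloured :: "'a set \<Rightarrow> ('a \<Rightarrow> 'a) \<times> ('a \<Rightarrow> nat)" where
  "identity_coloured S = (\<lambda>s \<in> S. s, \<lambda>s \<in> {}. undefined)"

datatype ('o, 'a) arrow =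
  Arrow (src: 'o) (tgt: 'o) (pair: "('a \<Rightarrow> 'a) \<times> ('a \<Rightarrow> nat)")

text \<open>
  The objects are the finite sets, respectively the totally ordered finite sets, with elements
  in the type \<open>'a\<close>; when \<open>'a\<close> is infinite, every finite set occurs up to bijection.
\<close>

type_synonym 'a fi_obj = "'a set"
type_synonym 'a fi_arr = "('a set, 'a) arrow"

definition FI :: "nat \<Rightarrow> ('a fi_obj, 'a fi_arr) cat" where
  "FI d = \<lparr>
    Obj = {S. finite S},
    Arr = {Arrow S T p | S T p. finite S \<and> finite T \<and> p \<in> coloured_injections d S T},
    Dom = src,
    Cod = tgt,
    Ident = (\<lambda>S. Arrow S S (identity_coloured S)),
    Comp = (\<lambda>b a. Arrow (src a) (tgt b)
      (compose_coloured (src a) (src b) (tgt b) (pair b) (pair a)))\<rparr>"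

type_synonym 'a oi_obj = "'a set \<times> 'a rel"
type_synonym 'a oi_arr = "('a oi_obj, 'a) arrow"

definition ordered_finite_sets :: "'a oi_obj set" where
  "ordered_finite_sets = {(S, r). finite S \<and> linear_order_on S r}"

definition order_preserving :: "'a oi_obj \<Rightarrow> 'a oi_obj \<Rightarrow> ('a \<Rightarrow> 'a) \<Rightarrow> bool" where
  "order_preserving X Y f \<longleftrightarrow> (\<forall>(a, b) \<in> snd X. (f a, f b) \<in> snd Y)"

definition OI :: "nat \<Rightarrow> ('a oi_obj, 'a oi_arr) cat" where
  "OI d = \<lparr>
    Obj = ordered_finite_sets,
    Arr = {Arrow X Y p | X Y p. X \<in> ordered_finite_sets \<and> Y \<in> ordered_finite_sets \<and>
      p \<in> coloured_injections d (fst X) (fst Y) \<and> order_preserving X Y (fst p)},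
    Dom = src,
    Cod = tgt,
    Ident = (\<lambda>X. Arrow X X (identity_coloured (fst X))),
    Comp = (\<lambda>b a. Arrow (src a) (tgt b)
      (compose_coloured (fst (src a)) (fst (src b)) (fst (tgt b)) (pair b) (pair a)))\<rparr>"

definition forget_order :: "('a oi_obj, 'a oi_arr, 'a fi_obj, 'a fi_arr) functor_data" where
  "forget_order = \<lparr>
    FObj = fst,
    FArr = (\<lambda>a. Arrow (fst (src a)) (fst (tgt a)) (pair a))\<rparr>"

end

(* A coloured injection S -> T into an ordered set T is a word indexed by T, over the alphabet
   consisting of S and the colours. Postcomposition inserts the same letters at the same places
   into all words of a given shape, so ordering words by their first difference is compatible with
   it; and since every element of S occurs exactly once, one word is a subword of another iff the
   first morphism divides the second, so noetherianity is Higman's lemma for a finite alphabet. *)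
theory Submission
  imports Defs "HOL-Library.Sublist" "HOL-Library.Infinite_Set"
begin

text \<open>\<open>FI d\<close> cannot itself carry the required orders: postcomposition with a
  nontrivial permutation of \<open>S\<close> is a bijection of the finite set Hom(S, S) that moves
  the identity, whereas a strictly increasing bijection of a finite linearly ordered set fixes
  everything. Total orders on the objects remove these automorphisms, at the price in property (F)
  of only the finitely many orders of \<open>S\<close>. Since the hom-sets of \<open>OI d\<close>
  are finite, a linear order on them is already a well-order, and the real condition is strict
  compatibility. For noetherianity the targets vary without bound, but the alphabet depends only on
  the source and on \<open>d\<close>. Letters are coded as naturals, colours being at most
  \<open>d\<close> and elements of \<open>S\<close> starting at \<open>Suc d\<close>, so the two
  kinds never collide and one coding serves both the comparison of letters and the alphabet.\<close>

section \<open>Words over a finite alphabet\<close>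

text \<open>Well-quasi-order in its strong form, with a whole increasing subsequence instead of one
  pair \<open>i < j\<close>: this form passes to unions and concatenations by thinning the sequence
  again, with no appeal to Ramsey's theorem.\<close>

definition subseq_wqo :: "'a list set \<Rightarrow> bool" where
  "subseq_wqo L \<longleftrightarrow>
    (\<forall>s :: nat \<Rightarrow> 'a list. range s \<subseteq> L \<longrightarrow>
      (\<exists>\<phi> :: nat \<Rightarrow> nat. strict_mono \<phi> \<and> (\<forall>i j. i \<le> j \<longrightarrow> subseq (s (\<phi> i)) (s (\<phi> j)))))"

lemma subseq_wqoD:
  assumes "subseq_wqo L" "\<And>i. s i \<in> L"
  obtains \<phi> :: "nat \<Rightarrow> nat" where "strict_mono \<phi>" "\<And>i j. i \<le> j \<Longrightarrow> subseq (s (\<phi> i)) (s (\<phi> j))"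
  using assms unfolding subseq_wqo_def by (metis image_subsetI)

lemma subseq_wqo_subset: "subseq_wqo L \<Longrightarrow> K \<subseteq> L \<Longrightarrow> subseq_wqo K"
  unfolding subseq_wqo_def by blast

lemma subseq_wqo_Un:
  assumes "subseq_wqo K" "subseq_wqo L"
  shows "subseq_wqo (K \<union> L)"
  unfolding subseq_wqo_def
proof (intro allI impI)
  fix s :: "nat \<Rightarrow> 'a list"
  assume "range s \<subseteq> K \<union> L"
  then have "{i. s i \<in> K} \<union> {i. s i \<in> L} = UNIV"
    by auto
  then have "infinite {i. s i \<in> K} \<or> infinite {i. s i \<in> L}"
    by (metis finite_Un infinite_UNIV_nat)
  then obtain M \<phi> where M: "subseq_wqo M" "strict_mono (\<phi> :: nat \<Rightarrow> nat)" "\<And>i. s (\<phi> i) \<in> M"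
    using assms infinite_enumerate by (metis (mono_tags) mem_Collect_eq)
  obtain \<psi> :: "nat \<Rightarrow> nat"
    where "strict_mono \<psi>" "\<And>i j. i \<le> j \<Longrightarrow> subseq (s (\<phi> (\<psi> i))) (s (\<phi> (\<psi> j)))"
    using subseq_wqoD[OF M(1), of "s \<circ> \<phi>"] M(3) by auto
  then show "\<exists>\<phi> :: nat \<Rightarrow> nat. strict_mono \<phi> \<and> (\<forall>i j. i \<le> j \<longrightarrow> subseq (s (\<phi> i)) (s (\<phi> j)))"
    using M(2) by (intro exI[of _ "\<phi> \<circ> \<psi>"]) (auto simp: strict_mono_def)
qed

lemma subseq_wqo_concat:
  assumes "subseq_wqo K" "subseq_wqo L"
  shows "subseq_wqo {u @ a # v | u v. u \<in> K \<and> v \<in> L}"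
  unfolding subseq_wqo_def
proof (intro allI impI)
  fix s :: "nat \<Rightarrow> 'a list"
  assume "range s \<subseteq> {u @ a # v | u v. u \<in> K \<and> v \<in> L}"
  then have "\<forall>i. \<exists>u v. s i = u @ a # v \<and> u \<in> K \<and> v \<in> L"
    by blast
  then obtain u v where s: "\<And>i. s i = u i @ a # v i" and uv: "\<And>i. u i \<in> K" "\<And>i. v i \<in> L"
    by metis
  obtain \<phi> :: "nat \<Rightarrow> nat"
    where \<phi>: "strict_mono \<phi>" "\<And>i j. i \<le> j \<Longrightarrow> subseq (u (\<phi> i)) (u (\<phi> j))"
    using subseq_wqoD[OF assms(1), of u] uv(1) by auto
  obtain \<psi> :: "nat \<Rightarrow> nat"
    where \<psi>: "strict_mono \<psi>" "\<And>i j. i \<le> j \<Longrightarrow> subseq (v (\<phi> (\<psi> i))) (v (\<phi> (\<psi> j)))"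
    using subseq_wqoD[OF assms(2), of "v \<circ> \<phi>"] uv(2) by auto
  \<comment> \<open>Thinning along \<open>\<psi>\<close> preserves the chain of first factors
    because \<open>\<psi>\<close> is monotone.\<close>
  have "subseq (s (\<phi> (\<psi> i))) (s (\<phi> (\<psi> j)))" if "i \<le> j" for i j
    unfolding s using \<phi>(2) \<psi> that
    by (intro list_emb_append_mono) (auto simp: strict_mono_less_eq)
  then show "\<exists>\<phi> :: nat \<Rightarrow> nat. strict_mono \<phi> \<and> (\<forall>i j. i \<le> j \<longrightarrow> subseq (s (\<phi> i)) (s (\<phi> j)))"
    using \<phi>(1) \<psi>(1) by (intro exI[of _ "\<phi> \<circ> \<psi>"]) (auto simp: strict_mono_def)
qed

text \<open>Induction on \<open>w = a # w'\<close>: a word avoiding \<open>w\<close> either does not contain \<open>a\<close>, or is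
  \<open>u @ a # v\<close> with \<open>u\<close> free of \<open>a\<close> and \<open>v\<close> avoiding \<open>w'\<close>.\<close>

lemma subseq_wqo_avoiding:
  assumes smaller: "\<And>B. B \<subset> A \<Longrightarrow> subseq_wqo (lists B)"
    and "w \<in> lists A"
  shows "subseq_wqo {v \<in> lists A. \<not> subseq w v}"
  using assms(2)
proof (induction w)
  case Nil
  then show ?case by (simp add: subseq_wqo_def)
next
  case (Cons a w)
  have A: "A - {a} \<subset> A"
    using Cons.hyps by blast
  have "{v \<in> lists A. \<not> subseq (a # w) v} \<subseteq> lists (A - {a}) \<union>
      {u @ a # v | u v. u \<in> lists (A - {a}) \<and> v \<in> {v \<in> lists A. \<not> subseq w v}}"
  proof
    fix x assume x: "x \<in> {v \<in> lists A. \<not> subseq (a # w) v}"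
    show "x \<in> lists (A - {a}) \<union>
      {u @ a # v | u v. u \<in> lists (A - {a}) \<and> v \<in> {v \<in> lists A. \<not> subseq w v}}"
    proof (cases "a \<in> set x")
      case True
      then obtain u v where uv: "x = u @ a # v" "a \<notin> set u"
        using split_list_first by metis
      moreover have "\<not> subseq w v"
        using x uv by (auto simp: list_emb_append2)
      ultimately show ?thesis
        using x by auto
    qed (use x in auto)
  qed
  then show ?case
    using subseq_wqo_Un[OF smaller[OF A] subseq_wqo_concat[OF smaller[OF A] Cons.IH]]
    by (rule subseq_wqo_subset[rotated])
qed

text \<open>If some term fails to embed into infinitely many others, these form a sequence avoiding
  it, which the proper subalphabets control. Otherwise each term embeds into all but finitely many,
  and an increasing chain is built greedily.\<close>

lemma higman_finite_alphabet: "finite A \<Longrightarrow> subseq_wqo (lists A)"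
proof (induction A rule: finite_psubset_induct)
  case (psubset A)
  show ?case
    unfolding subseq_wqo_def
  proof (intro allI impI)
    fix s :: "nat \<Rightarrow> 'a list"
    assume "range s \<subseteq> lists A"
    then have s: "s i \<in> lists A" for i
      by blast
    show "\<exists>\<phi> :: nat \<Rightarrow> nat. strict_mono \<phi> \<and> (\<forall>i j. i \<le> j \<longrightarrow> subseq (s (\<phi> i)) (s (\<phi> j)))"
    proof (cases "\<exists>i. infinite {j. \<not> subseq (s i) (s j)}")
      case True
      then obtain i and \<phi> :: "nat \<Rightarrow> nat" where \<phi>: "strict_mono \<phi>" "\<And>j. \<not> subseq (s i) (s (\<phi> j))"
        using infinite_enumerate by blast
      obtain \<psi> :: "nat \<Rightarrow> nat"
        where "strict_mono \<psi>" "\<And>i j. i \<le> j \<Longrightarrow> subseq (s (\<phi> (\<psi> i))) (s (\<phi> (\<psi> j)))"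
        using subseq_wqoD[OF subseq_wqo_avoiding[OF psubset.IH s[of i]], of "s \<circ> \<phi>"] \<phi>(2) s
        by auto
      then show ?thesis
        using \<phi>(1) by (intro exI[of _ "\<phi> \<circ> \<psi>"]) (auto simp: strict_mono_def)
    next
      case False
      then have "\<exists>n. \<forall>j\<ge>n. subseq (s i) (s j)" for i
        by (metis (mono_tags, lifting) finite_nat_set_iff_bounded mem_Collect_eq not_less)
      then have "\<exists>n'>n. subseq (s n) (s n')" for n
        by (meson le_Suc_eq less_Suc_eq_le nat_le_linear le_trans)
      then obtain \<phi> :: "nat \<Rightarrow> nat"
        where \<phi>: "\<And>n. \<phi> n < \<phi> (Suc n)" "\<And>n. subseq (s (\<phi> n)) (s (\<phi> (Suc n)))"
        using dependent_nat_choice[of "\<lambda>_ _. True" "\<lambda>_ n n'. n < n' \<and> subseq (s n) (s n')"]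
        by auto
      have "subseq (s (\<phi> i)) (s (\<phi> j))" if "i \<le> j" for i j
        using that by (induction rule: dec_induct) (use \<phi>(2) subseq_order.trans in auto)
      then show ?thesis
        using \<phi>(1) by (auto simp: strict_mono_Suc_iff)
    qed
  qed
qed

section \<open>Maps induced by subwords, and sorted lists\<close>

lemma map_eq_obtain:
  assumes "distinct xs" "length xs = length zs"
  obtains h where "map h xs = zs"
proof -
  have "\<exists>h. map h xs = zs"
    using assms(2,1)
  proof (induction xs zs rule: list_induct2)
    case (Cons x xs z zs)
    then obtain h where "map h xs = zs"
      by auto
    then have "map (h(x := z)) (x # xs) = z # zs"
      using Cons.prems by auto
    then show ?case
      by metis
  qed simp
  then show ?thesis
    using that by blast
qed

text \<open>A subword is a choice of positions (\<open>nths\<close>); \<open>h\<close> sends the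
  k-th entry of \<open>xs\<close> to the k-th chosen entry of \<open>ys\<close>, which is well
  defined because \<open>xs\<close> is distinct.\<close>

lemma subseq_map_obtain:
  assumes "subseq (map w xs) (map w' ys)" "distinct xs"
  obtains h where "subseq (map h xs) ys" "\<And>x. x \<in> set xs \<Longrightarrow> w' (h x) = w x"
proof -
  obtain N where N: "map w xs = map w' (nths ys N)"
    using assms(1) unfolding subseq_conv_nths nths_map by blast
  then obtain h where h: "map h xs = nths ys N"
    using map_eq_obtain[OF assms(2), of "nths ys N"] map_eq_imp_length_eq by blast
  show ?thesis
  proof
    show "subseq (map h xs) ys"
      unfolding h subseq_conv_nths by blast
    show "w' (h x) = w x" if "x \<in> set xs" for x
      using N that unfolding h[symmetric] by auto
  qed
qed

lemma sorted_wrt_subseq: "subseq xs ys \<Longrightarrow> sorted_wrt P ys \<Longrightarrow> sorted_wrt P xs"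
  by (induction rule: list_emb.induct) (auto dest: list_emb_set)

text \<open>Stated for subsets \<open>A\<close> of \<open>S\<close> so that the induction can add
  points one by one while \<open>r\<close> stays a linear order on the fixed set
  \<open>S\<close>.\<close>

lemma finite_linear_order_list:
  assumes "finite A" "linear_order_on S r" "A \<subseteq> S"
  shows "\<exists>xs. set xs = A \<and> sorted_wrt (\<lambda>a b. (a, b) \<in> r - Id) xs"
  using assms(1,3)
proof (induction A)
  case (insert x A)
  then obtain xs where xs: "set xs = A" "sorted_wrt (\<lambda>a b. (a, b) \<in> r - Id) xs"
    by auto
  have r: "trans r" "antisym r" "total_on S r"
    using assms(2) by (auto simp: order_on_defs)
  let ?ys = "filter (\<lambda>a. (a, x) \<in> r) xs @ x # filter (\<lambda>a. (x, a) \<in> r) xs"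
  have "set ?ys = insert x A"
    using xs(1) r(3) insert.hyps insert.prems unfolding total_on_def by auto
  moreover have "sorted_wrt (\<lambda>a b. (a, b) \<in> r - Id) ?ys"
    using xs insert.hyps r(1,2)
    by (auto simp: sorted_wrt_append sorted_wrt_filter dest: transD antisymD)
  ultimately show ?case
    by blast
qed auto

text \<open>Recovers monotonicity of \<open>h\<close> from sortedness of two lists: were
  \<open>y\<close> listed before \<open>x\<close>, the first list would give
  \<open>P y x\<close>.\<close>

lemma sorted_wrt_map_in_order:
  assumes "sorted_wrt P xs" "sorted_wrt Q (map h xs)" "x \<in> set xs" "y \<in> set xs"
    "x \<noteq> y" "\<not> P y x"
  shows "Q (h x) (h y)"
proof -
  obtain i j where ij: "i < length xs" "j < length xs" "x = xs ! i" "y = xs ! j"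
    using assms by (metis in_set_conv_nth)
  then have "i < j"
    using assms(1,5,6) by (metis linorder_neqE_nat sorted_wrt_nth_less)
  then show ?thesis
    using ij assms(2) sorted_wrt_nth_less[of Q "map h xs" i j] by simp
qed

section \<open>Composition of coloured injections\<close>

lemma coloured_injectionsD:
  assumes "p \<in> coloured_injections d S T"
  shows "fst p \<in> S \<rightarrow>\<^sub>E T" "inj_on (fst p) S" "snd p \<in> (T - fst p ` S) \<rightarrow>\<^sub>E {1..d}"
    "\<And>s. s \<in> S \<Longrightarrow> fst p s \<in> T" "fst p ` S \<subseteq> T"
    "\<And>t. t \<in> T \<Longrightarrow> t \<notin> fst p ` S \<Longrightarrow> snd p t \<in> {1..d}"
  using assms by (auto simp: coloured_injections_def)

lemma coloured_injections_eqI: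
  assumes "p \<in> coloured_injections d S T" "p' \<in> coloured_injections d S T"
    and fst: "\<And>s. s \<in> S \<Longrightarrow> fst p s = fst p' s"
    and snd: "\<And>t. t \<in> T \<Longrightarrow> t \<notin> fst p ` S \<Longrightarrow> snd p t = snd p' t"
  shows "p = p'"
proof (rule prod_eqI)
  show eq: "fst p = fst p'"
    using coloured_injectionsD(1)[OF assms(1)] coloured_injectionsD(1)[OF assms(2)] fst
    by (rule PiE_ext)
  show "snd p = snd p'"
    using coloured_injectionsD(3)[OF assms(1)] coloured_injectionsD(3)[OF assms(2)] snd
    unfolding eq by (intro PiE_ext) auto
qed

lemma finite_coloured_injections:
  assumes "finite S" "finite T"
  shows "finite (coloured_injections d S T)"
proof (rule finite_subset)
  \<comment> \<open>The domain of the colouring depends on the injection, so the bound runs over all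
    subsets \<open>D\<close> of \<open>T\<close>.\<close>
  show "coloured_injections d S T \<subseteq> (S \<rightarrow>\<^sub>E T) \<times> (\<Union>D \<in> Pow T. D \<rightarrow>\<^sub>E {1..d})"
    by (auto simp: coloured_injections_def)
  show "finite ((S \<rightarrow>\<^sub>E T) \<times> (\<Union>D \<in> Pow T. D \<rightarrow>\<^sub>E {1..d}))"
    using assms finite_subset[OF _ assms(2)]
    by (intro finite_cartesian_product finite_UN_I finite_PiE) auto
qed

lemma fst_compose_coloured:
  "s \<in> S \<Longrightarrow> fst (compose_coloured S T U q p) s = fst q (fst p s)"
  by (simp add: compose_coloured_def compose_def)

lemma image_compose_coloured:
  "fst (compose_coloured S T U q p) ` S = fst q ` fst p ` S"
  by (force simp: fst_compose_coloured)

lemma snd_compose_coloured_image: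
  assumes "p \<in> coloured_injections d S T" "q \<in> coloured_injections d T U"
    and "t \<in> T" "t \<notin> fst p ` S"
  shows "snd (compose_coloured S T U q p) (fst q t) = snd p t"
proof -
  note q = coloured_injectionsD[OF assms(2)]
  have "fst q t \<notin> fst q ` fst p ` S"
    using assms(3,4) q(2) coloured_injectionsD(5)[OF assms(1)]
    by (metis inj_on_image_mem_iff)
  then show ?thesis
    using assms(3) q(2,4)
    by (simp add: compose_coloured_def compose_colouring_def case_prod_beta the_inv_into_f_f)
qed

lemma snd_compose_coloured_outside:
  assumes "p \<in> coloured_injections d S T" "u \<in> U" "u \<notin> fst q ` T"
  shows "snd (compose_coloured S T U q p) u = snd q u"
  using assms coloured_injectionsD(5)[OF assms(1)]
  by (auto simp: compose_coloured_def compose_colouring_def case_prod_beta)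

lemma compose_coloured_closed:
  assumes p: "p \<in> coloured_injections d S T" and q: "q \<in> coloured_injections d T U"
  shows "compose_coloured S T U q p \<in> coloured_injections d S U" (is "?c \<in> _")
proof -
  note pD = coloured_injectionsD[OF p] and qD = coloured_injectionsD[OF q]
  have "fst ?c \<in> S \<rightarrow>\<^sub>E U"
    using pD(4) qD(4) by (auto simp: compose_coloured_def compose_def)
  moreover have "inj_on (fst ?c) S"
    using pD(2,4) qD(2) by (auto simp: inj_on_def fst_compose_coloured)
  moreover have "snd ?c \<in> (U - fst ?c ` S) \<rightarrow>\<^sub>E {1..d}"
  proof (rule PiE_I)
    fix u assume u: "u \<in> U - fst ?c ` S"
    show "snd ?c u \<in> {1..d}"
    proof (cases "u \<in> fst q ` T")
      case True
      then obtain t where t: "t \<in> T" "u = fst q t"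
        by blast
      then have "t \<notin> fst p ` S"
        using u by (auto simp: image_compose_coloured)
      then show ?thesis
        using t snd_compose_coloured_image[OF p q t(1)] pD(6) by simp
    next
      case False
      then show ?thesis
        using u snd_compose_coloured_outside[OF p] qD(6) by simp
    qed
  next
    fix u assume u: "u \<notin> U - fst ?c ` S"
    then show "snd ?c u = undefined"
      unfolding image_compose_coloured
      by (auto simp: compose_coloured_def compose_colouring_def case_prod_beta)
  qed
  ultimately show ?thesis
    by (simp add: coloured_injections_def case_prod_beta)
qed

lemma compose_coloured_assoc:
  assumes p: "p \<in> coloured_injections d S T" and q: "q \<in> coloured_injections d T U"
    and r: "r \<in> coloured_injections d U V"
  shows "compose_coloured S U V r (compose_coloured S T U q p) =
    compose_coloured S T V (compose_coloured T U V r q) p"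
proof (rule coloured_injections_eqI)
  let ?qp = "compose_coloured S T U q p" and ?rq = "compose_coloured T U V r q"
  have qp: "?qp \<in> coloured_injections d S U" and rq: "?rq \<in> coloured_injections d T V"
    using assms compose_coloured_closed by blast+
  show "compose_coloured S U V r ?qp \<in> coloured_injections d S V"
    "compose_coloured S T V ?rq p \<in> coloured_injections d S V"
    using compose_coloured_closed[OF qp r] compose_coloured_closed[OF p rq] .
  show "fst (compose_coloured S U V r ?qp) s = fst (compose_coloured S T V ?rq p) s"
    if "s \<in> S" for s
    using that coloured_injectionsD(4)[OF p that] by (simp add: fst_compose_coloured)
  fix v assume v: "v \<in> V" "v \<notin> fst (compose_coloured S U V r ?qp) ` S"
  \<comment> \<open>A point comes from \<open>T\<close>, from \<open>U\<close> but not
    \<open>T\<close>, or from neither; both sides then colour it by \<open>p\<close>,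
    \<open>q\<close> or \<open>r\<close> respectively.\<close>
  consider (T) t where "t \<in> T" "v = fst r (fst q t)"
    | (U) u where "u \<in> U" "u \<notin> fst q ` T" "v = fst r u" | (V) "v \<notin> fst r ` U"
    by blast
  then show "snd (compose_coloured S U V r ?qp) v = snd (compose_coloured S T V ?rq p) v"
  proof cases
    case T
    have t: "t \<notin> fst p ` S"
      using v(2) T(2) by (auto simp: image_compose_coloured)
    have qt: "fst q t \<in> U" "fst q t \<notin> fst ?qp ` S"
      using v(2) T coloured_injectionsD(4)[OF q] by (auto simp: image_compose_coloured)
    have "snd (compose_coloured S U V r ?qp) v = snd p t"
      using snd_compose_coloured_image[OF qp r qt] snd_compose_coloured_image[OF p q T(1) t] T(2)
      by simp
    moreover have "snd (compose_coloured S T V ?rq p) v = snd p t"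
      using snd_compose_coloured_image[OF p rq T(1) t] T by (simp add: fst_compose_coloured)
    ultimately show ?thesis
      by simp
  next
    case U
    have u: "u \<notin> fst ?qp ` S"
      using v(2) U(3) by (auto simp: image_compose_coloured)
    have "fst r u \<notin> fst r ` fst q ` T"
      using U(1,2) coloured_injectionsD(2)[OF r] coloured_injectionsD(5)[OF q]
      by (metis inj_on_image_mem_iff)
    then have v': "v \<notin> fst ?rq ` T"
      by (simp add: image_compose_coloured U(3))
    have "snd (compose_coloured S U V r ?qp) v = snd q u"
      using snd_compose_coloured_image[OF qp r U(1) u]
        snd_compose_coloured_outside[OF p U(1,2)] U(3)
      by simp
    moreover have "snd (compose_coloured S T V ?rq p) v = snd q u"
      using snd_compose_coloured_outside[OF p v(1) v']
        snd_compose_coloured_image[OF q r U(1,2)] U(3)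
      by simp
    ultimately show ?thesis
      by simp
  next
    case V
    then have "v \<notin> fst ?rq ` T"
      using coloured_injectionsD(5)[OF q] by (auto simp: image_compose_coloured)
    then show ?thesis
      using V v(1) snd_compose_coloured_outside[OF qp] snd_compose_coloured_outside[OF p]
        snd_compose_coloured_outside[OF q]
      by simp
  qed
qed

lemma identity_coloured_closed: "identity_coloured S \<in> coloured_injections d S S"
  by (auto simp: identity_coloured_def coloured_injections_def inj_on_def)

lemma fst_identity_coloured: "s \<in> S \<Longrightarrow> fst (identity_coloured S) s = s"
  by (simp add: identity_coloured_def)

lemma image_identity_coloured: "fst (identity_coloured S) ` S = S"
  by (force simp: fst_identity_coloured)

lemma compose_coloured_identity_right:
  assumes p: "p \<in> coloured_injections d S T"
  shows "compose_coloured S S T p (identity_coloured S) = p"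
proof (rule coloured_injections_eqI)
  show "compose_coloured S S T p (identity_coloured S) \<in> coloured_injections d S T"
    using compose_coloured_closed[OF identity_coloured_closed p] .
  show "snd (compose_coloured S S T p (identity_coloured S)) t = snd p t"
    if "t \<in> T" "t \<notin> fst (compose_coloured S S T p (identity_coloured S)) ` S" for t
    using that snd_compose_coloured_outside[OF identity_coloured_closed]
    by (simp add: image_compose_coloured image_identity_coloured)
qed (simp_all add: p fst_compose_coloured fst_identity_coloured)

lemma compose_coloured_identity_left:
  assumes p: "p \<in> coloured_injections d S T"
  shows "compose_coloured S T T (identity_coloured T) p = p"
proof (rule coloured_injections_eqI)
  note pD = coloured_injectionsD[OF p]
  show "compose_coloured S T T (identity_coloured T) p \<in> coloured_injections d S T"
    using compose_coloured_closed[OF p identity_coloured_closed] .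
  show "fst (compose_coloured S T T (identity_coloured T) p) s = fst p s" if "s \<in> S" for s
    using that pD(4) by (simp add: fst_compose_coloured fst_identity_coloured)
  fix t assume t: "t \<in> T" "t \<notin> fst (compose_coloured S T T (identity_coloured T) p) ` S"
  then have "t \<notin> fst p ` S"
    using pD(4) fst_identity_coloured
    by (fastforce simp: fst_compose_coloured image_iff)
  then show "snd (compose_coloured S T T (identity_coloured T) p) t = snd p t"
    using snd_compose_coloured_image[OF p identity_coloured_closed t(1)] t(1)
    by (simp add: fst_identity_coloured)
qed (use p in auto)


section \<open>Coloured injections as words\<close>

text \<open>A coloured injection \<open>S \<rightarrow> T\<close> is a labelling of \<open>T\<close> by \<open>S\<close> and the colours, in which every
  element of \<open>S\<close> occurs once. An injection \<open>e\<close> of \<open>S\<close> into the naturals codes the labels.\<close>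

definition letter ::
    "nat \<Rightarrow> ('a \<Rightarrow> nat) \<Rightarrow> 'a set \<Rightarrow> ('a \<Rightarrow> 'a) \<times> ('a \<Rightarrow> nat) \<Rightarrow> 'a \<Rightarrow> nat" where
  "letter d e S p t =
    (if t \<in> fst p ` S then Suc d + e (the_inv_into S (fst p) t) else snd p t)"

lemma letter_image:
  "p \<in> coloured_injections d S T \<Longrightarrow> s \<in> S \<Longrightarrow> letter d e S p (fst p s) = Suc d + e s"
  using coloured_injectionsD(2) by (fastforce simp: letter_def the_inv_into_f_f)

lemma letter_outside: "t \<notin> fst p ` S \<Longrightarrow> letter d e S p t = snd p t"
  by (simp add: letter_def)

text \<open>The alphabet does not mention \<open>T\<close>, so morphisms out of \<open>S\<close>
  with different targets give words over the same letters.\<close>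

lemma letter_mem_alphabet:
  assumes "p \<in> coloured_injections d S T" "t \<in> T"
  shows "letter d e S p t \<in> {..d} \<union> (\<lambda>s. Suc d + e s) ` S"
proof (cases "t \<in> fst p ` S")
  case True
  then show ?thesis
    using letter_image[OF assms(1)] by auto
next
  case False
  then show ?thesis
    using coloured_injectionsD(6)[OF assms False] by (simp add: letter_outside)
qed

text \<open>Colours are at most \<open>d\<close> and codes of \<open>S\<close> exceed
  \<open>d\<close>; as \<open>e\<close> is injective on \<open>S\<close>, the letter of
  \<open>s\<close> marks a single position.\<close>

lemma letter_eq_imageD:
  assumes p: "p \<in> coloured_injections d S T" and "inj_on e S" "s \<in> S" "t \<in> T"
    and eq: "letter d e S p t = Suc d + e s"
  shows "t = fst p s"
proof (cases "t \<in> fst p ` S")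
  case True
  then obtain s' where "s' \<in> S" "t = fst p s'"
    by blast
  then show ?thesis
    using eq letter_image[OF p] assms(2,3) by (auto dest: inj_onD)
next
  case False
  then show ?thesis
    using eq coloured_injectionsD(6)[OF p assms(4)] by (simp add: letter_outside)
qed

text \<open>The position of the letter of \<open>s\<close> is \<open>fst p s\<close>, and the other
  letters are the colouring. This makes the order on hom-sets total and lets factorisations be
  checked letter by letter.\<close>

lemma letter_inject:
  assumes p: "p \<in> coloured_injections d S T" and p': "p' \<in> coloured_injections d S T"
    and "inj_on e S" and eq: "\<And>t. t \<in> T \<Longrightarrow> letter d e S p t = letter d e S p' t"
  shows "p = p'"
proof (rule coloured_injections_eqI[OF p p'])
  show fst: "fst p s = fst p' s" if "s \<in> S" for s
  proof (rule letter_eq_imageD[OF p' assms(3) that])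
    show "fst p s \<in> T"
      using coloured_injectionsD(4)[OF p that] .
    then show "letter d e S p' (fst p s) = Suc d + e s"
      using eq letter_image[OF p that, of e] by simp
  qed
  fix t assume t: "t \<in> T" "t \<notin> fst p ` S"
  have "t \<notin> fst p' ` S"
    using t fst by auto
  then show "snd p t = snd p' t"
    using eq[OF t(1)] t(2) by (simp add: letter_outside)
qed

lemma letter_compose_image:
  assumes p: "p \<in> coloured_injections d S T" and q: "q \<in> coloured_injections d T U"
    and "t \<in> T"
  shows "letter d e S (compose_coloured S T U q p) (fst q t) = letter d e S p t"
proof (cases "t \<in> fst p ` S")
  case True
  then obtain s where s: "s \<in> S" "t = fst p s"
    by blast
  then show ?thesis
    using letter_image[OF p s(1)] letter_image[OF compose_coloured_closed[OF p q] s(1)]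
    by (simp add: fst_compose_coloured)
next
  case False
  then have "fst q t \<notin> fst (compose_coloured S T U q p) ` S"
    unfolding image_compose_coloured
    using assms(3) coloured_injectionsD(5)[OF p] coloured_injectionsD(2)[OF q]
    by (metis inj_on_image_mem_iff)
  then show ?thesis
    using False snd_compose_coloured_image[OF p q assms(3)] by (simp add: letter_outside)
qed

lemma letter_compose_outside:
  assumes p: "p \<in> coloured_injections d S T" and "u \<in> U" "u \<notin> fst q ` T"
  shows "letter d e S (compose_coloured S T U q p) u = snd q u"
proof -
  have "u \<notin> fst (compose_coloured S T U q p) ` S"
    using assms(3) coloured_injectionsD(5)[OF p] by (auto simp: image_compose_coloured)
  then show ?thesis
    using snd_compose_coloured_outside[OF assms] by (simp add: letter_outside)
qed

lemma coloured_injection_factors: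
  assumes p: "p \<in> coloured_injections d S T" and p': "p' \<in> coloured_injections d S U"
    and "inj_on e S" "inj_on h T" "h ` T \<subseteq> U"
    and letters: "\<And>t. t \<in> T \<Longrightarrow> letter d e S p' (h t) = letter d e S p t"
  obtains q where "q \<in> coloured_injections d T U" "fst q = restrict h T"
    "p' = compose_coloured S T U q p"
proof
  let ?q = "(restrict h T, restrict (snd p') (U - h ` T))"
  have image: "fst p' ` S \<subseteq> h ` T"
  proof
    fix u assume "u \<in> fst p' ` S"
    then obtain s where s: "s \<in> S" "u = fst p' s"
      by blast
    have t: "fst p s \<in> T"
      using coloured_injectionsD(4)[OF p s(1)] .
    then have "letter d e S p' (h (fst p s)) = Suc d + e s"
      using letters letter_image[OF p s(1)] by simp
    then have "h (fst p s) = u"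
      using letter_eq_imageD[OF p' assms(3) s(1)] t assms(5) s(2) by blast
    then show "u \<in> h ` T"
      using t by blast
  qed
  have imageq: "fst ?q ` T = h ` T"
    by auto
  show q: "?q \<in> coloured_injections d T U"
  proof -
    have "restrict (snd p') (U - h ` T) \<in> U - h ` T \<rightarrow>\<^sub>E {1..d}"
      using image coloured_injectionsD(6)[OF p'] by (intro restrict_PiE_iff[THEN iffD2]) blast
    then show ?thesis
      using assms(4,5) imageq by (auto simp: coloured_injections_def inj_on_restrict_eq)
  qed
  show "fst ?q = restrict h T"
    by simp
  show "p' = compose_coloured S T U ?q p"
  proof (rule letter_inject[OF p' compose_coloured_closed[OF p q] assms(3)])
    fix u assume u: "u \<in> U"
    show "letter d e S p' u = letter d e S (compose_coloured S T U ?q p) u"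
    proof (cases "u \<in> h ` T")
      case True
      then obtain t where "t \<in> T" "u = h t"
        by blast
      then show ?thesis
        using letters letter_compose_image[OF p q, of t e] by simp
    next
      case False
      then have "u \<notin> fst p' ` S"
        using image by blast
      then show ?thesis
        using False u letter_compose_outside[OF p u, of ?q] imageq by (simp add: letter_outside)
    qed
  qed
qed


section \<open>The categories and the forgetful functor\<close>

lemma hom_FI_iff:
  "a \<in> hom (FI d) S T \<longleftrightarrow>
    (\<exists>p. a = Arrow S T p \<and> finite S \<and> finite T \<and> p \<in> coloured_injections d S T)"
  by (auto simp: hom_def FI_def)

lemma FI_simps:
  "Obj (FI d) = {S. finite S}" "Ident (FI d) S = Arrow S S (identity_coloured S)"
  "Comp (FI d) (Arrow T U q) (Arrow S T p) = Arrow S U (compose_coloured S T U q p)"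
  by (simp_all add: FI_def)

lemma category_FI: "category (FI d)"
proof
  show "Dom (FI d) f \<in> Obj (FI d)" "Cod (FI d) f \<in> Obj (FI d)" if "f \<in> Arr (FI d)" for f :: "'a fi_arr"
    using that by (auto simp: FI_def)
qed (auto simp: hom_FI_iff FI_simps identity_coloured_closed compose_coloured_closed
      compose_coloured_assoc compose_coloured_identity_left compose_coloured_identity_right
      simp del: split_paired_Ex split_paired_All)

lemma hom_OI_iff:
  "a \<in> hom (OI d) X Y \<longleftrightarrow>
    (\<exists>p. a = Arrow X Y p \<and> X \<in> ordered_finite_sets \<and> Y \<in> ordered_finite_sets \<and>
      p \<in> coloured_injections d (fst X) (fst Y) \<and> order_preserving X Y (fst p))"
  by (auto simp: hom_def OI_def simp del: split_paired_Ex)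

lemma OI_simps:
  "Obj (OI d) = ordered_finite_sets" "Ident (OI d) X = Arrow X X (identity_coloured (fst X))"
  "Comp (OI d) (Arrow Y Z q) (Arrow X Y p) =
    Arrow X Z (compose_coloured (fst X) (fst Y) (fst Z) q p)"
  by (simp_all add: OI_def)

lemma ordered_finite_setsD:
  assumes "X \<in> ordered_finite_sets"
  shows "finite (fst X)" "linear_order_on (fst X) (snd X)" "snd X \<subseteq> fst X \<times> fst X"
    "trans (snd X)" "antisym (snd X)" "total_on (fst X) (snd X)" "refl_on (fst X) (snd X)"
  using assms by (auto simp: ordered_finite_sets_def order_on_defs)

lemma order_preserving_compose_coloured:
  assumes "X \<in> ordered_finite_sets" "order_preserving X Y (fst p)" "order_preserving Y Z (fst q)"
  shows "order_preserving X Z (fst (compose_coloured (fst X) (fst Y) (fst Z) q p))"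
  using assms(2,3) ordered_finite_setsD(3)[OF assms(1)]
  by (fastforce simp: order_preserving_def fst_compose_coloured)

lemma order_preserving_identity_coloured:
  "X \<in> ordered_finite_sets \<Longrightarrow> order_preserving X X (fst (identity_coloured (fst X)))"
  using ordered_finite_setsD(3)[of X] by (fastforce simp: order_preserving_def fst_identity_coloured)

lemma category_OI: "category (OI d)"
proof
  show "Dom (OI d) f \<in> Obj (OI d)" "Cod (OI d) f \<in> Obj (OI d)" if "f \<in> Arr (OI d)" for f :: "'a oi_arr"
    using that by (auto simp: OI_def)
  show "Comp (OI d) g f \<in> hom (OI d) X Z" if "f \<in> hom (OI d) X Y" "g \<in> hom (OI d) Y Z"
    for f g :: "'a oi_arr" and X Y Z
  proof -
    obtain p q where "f = Arrow X Y p" "g = Arrow Y Z q"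
      using \<open>f \<in> _\<close> \<open>g \<in> _\<close> unfolding hom_OI_iff by blast
    then show ?thesis
      using \<open>f \<in> _\<close> \<open>g \<in> _\<close>
      by (simp add: hom_OI_iff OI_simps compose_coloured_closed order_preserving_compose_coloured)
  qed
qed (auto simp: hom_OI_iff OI_simps identity_coloured_closed compose_coloured_closed
      compose_coloured_assoc compose_coloured_identity_left compose_coloured_identity_right
      order_preserving_identity_coloured
      simp del: split_paired_Ex split_paired_All)

lemma forget_order_functor: "cat_functor (OI d) (FI d) forget_order"
proof (intro cat_functor.intro cat_functor_axioms.intro category_OI category_FI)
  show "FObj forget_order X \<in> Obj (FI d)" if "X \<in> Obj (OI d)" for X :: "'a oi_obj"
    using that by (simp add: OI_simps FI_simps forget_order_def ordered_finite_setsD(1))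
  show "FArr forget_order a \<in> hom (FI d) (FObj forget_order X) (FObj forget_order Y)"
    if "a \<in> hom (OI d) X Y" for a :: "'a oi_arr" and X Y
    using that by (force simp: hom_OI_iff hom_FI_iff forget_order_def ordered_finite_setsD(1))
  show "FArr forget_order (Ident (OI d) X) = Ident (FI d) (FObj forget_order X)"
    for X :: "'a oi_obj"
    by (simp add: OI_def FI_def forget_order_def)
  show "FArr forget_order (Comp (OI d) b a) = Comp (FI d) (FArr forget_order b) (FArr forget_order a)"
    for a b :: "'a oi_arr"
    by (simp add: OI_def FI_def forget_order_def)
qed

section \<open>Essential surjectivity and property (F)\<close>

lemma ex_linear_order_on: "\<exists>r. linear_order_on S r"
  using well_order_on[of S] by (auto simp: well_order_on_def)

lemma finite_linear_orders: "finite S \<Longrightarrow> finite {r. linear_order_on S r}"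
  by (rule finite_subset[of _ "Pow (S \<times> S)"]) (auto simp: order_on_defs)

text \<open>Every finite set is itself the image of an object, by any linear order on it, so the
  isomorphism is an identity.\<close>

lemma forget_order_essentially_surjective: "essentially_surjective (OI d) (FI d) forget_order"
  unfolding essentially_surjective_def
proof (intro conjI ballI forget_order_functor)
  fix S :: "'a set"
  assume "S \<in> Obj (FI d)"
  then have S: "finite S"
    by (simp add: FI_simps)
  obtain r where r: "linear_order_on S r"
    using ex_linear_order_on by blast
  interpret category "FI d :: ('a fi_obj, 'a fi_arr) cat"
    by (rule category_FI)
  have "isomorphic (FI d) S S"
    unfolding isomorphic_def using ident_closed[OF \<open>S \<in> Obj (FI d)\<close>] comp_ident_left by blast
  then show "\<exists>Y \<in> Obj (OI d). isomorphic (FI d) (FObj forget_order Y) S"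
    using S r by (intro bexI[of _ "(S, r)"]) (auto simp: OI_simps ordered_finite_sets_def forget_order_def)
qed

lemma linear_order_on_pullback:
  assumes "inj_on f S" "f ` S \<subseteq> T" "linear_order_on T r"
  shows "linear_order_on S {(a, b). a \<in> S \<and> b \<in> S \<and> (f a, f b) \<in> r}"
proof -
  have r: "trans r" "antisym r" "total_on T r" "refl_on T r"
    using assms(3) by (auto simp: order_on_defs)
  let ?r = "{(a, b). a \<in> S \<and> b \<in> S \<and> (f a, f b) \<in> r}"
  have "refl_on S ?r" "trans ?r"
    using assms(2) r(4) transD[OF r(1)] by (auto simp: refl_on_def intro!: transI)
  moreover have "antisym ?r"
    using assms(1) antisymD[OF r(2)] by (auto intro!: antisymI dest: inj_onD)
  moreover have "total_on S ?r"
    using assms(1,2) r(3) by (auto simp: total_on_def inj_on_def) blast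
  ultimately show ?thesis
    by (auto simp: order_on_defs)
qed

text \<open>A map \<open>S \<rightarrow> T\<close> into an ordered set is order-preserving for the order pulled back to \<open>S\<close>, so
  it factors through the identity of \<open>S\<close> equipped with one of the finitely many orders of \<open>S\<close>.\<close>

lemma forget_order_property_F: "property_F (OI d) (FI d) forget_order"
  unfolding property_F_def
proof (intro conjI ballI forget_order_functor)
  fix S :: "'a set"
  assume "S \<in> Obj (FI d)"
  then have S: "finite S"
    by (simp add: FI_simps)
  obtain n and r :: "nat \<Rightarrow> 'a rel" where r: "r ` {1..n} = {r. linear_order_on S r}"
    using finite_imp_nat_seg_image_inj_on[OF finite_linear_orders[OF S]]
      ex_bij_betw_nat_finite_1[OF finite_linear_orders[OF S]]
    by (metis bij_betw_imp_surj_on)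
  \<comment> \<open>All the morphisms \<open>f i\<close> are the identity of \<open>S\<close>; only
    the order put on \<open>S\<close> varies with \<open>i\<close>.\<close>
  let ?y = "\<lambda>i. (S, r i)" and ?f = "\<lambda>i. Arrow S S (identity_coloured S)"
  have y: "?y i \<in> ordered_finite_sets" if "i \<in> {1..n}" for i
    using that r S by (auto simp: ordered_finite_sets_def)
  have "\<forall>i \<in> {1..n}. ?y i \<in> Obj (OI d) \<and> ?f i \<in> hom (FI d) S (FObj forget_order (?y i))"
    using S y by (auto simp: hom_FI_iff forget_order_def OI_simps identity_coloured_closed)
  moreover have "\<exists>i \<in> {1..n}. \<exists>g \<in> hom (OI d) (?y i) Z. h = Comp (FI d) (FArr forget_order g) (?f i)"
    if "Z \<in> Obj (OI d)" and h: "h \<in> hom (FI d) S (FObj forget_order Z)" for Z h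
  proof -
    have Z: "Z \<in> ordered_finite_sets"
      using that(1) by (simp add: OI_simps)
    obtain p where p: "h = Arrow S (fst Z) p" "p \<in> coloured_injections d S (fst Z)"
      using h by (auto simp: hom_FI_iff forget_order_def)
    note pD = coloured_injectionsD[OF p(2)]
    obtain i where i: "i \<in> {1..n}" "r i = {(a, b). a \<in> S \<and> b \<in> S \<and> (fst p a, fst p b) \<in> snd Z}"
      using linear_order_on_pullback[OF pD(2,5) ordered_finite_setsD(2)[OF Z]] r
      by (smt (verit) imageE mem_Collect_eq)
    \<comment> \<open>The same pair \<open>p\<close> is reused with an ordered source; it preserves
      the order by the choice of \<open>r i\<close>.\<close>
    have "Arrow (?y i) Z p \<in> hom (OI d) (?y i) Z"
      using y[OF i(1)] Z p(2) i(2) by (auto simp: hom_OI_iff order_preserving_def)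
    moreover have "h = Comp (FI d) (FArr forget_order (Arrow (?y i) Z p)) (?f i)"
      by (simp add: forget_order_def FI_simps p(1) compose_coloured_identity_right[OF p(2)])
    ultimately show ?thesis
      using i(1) by blast
  qed
  ultimately show "\<exists>(n::nat) (y :: nat \<Rightarrow> 'a oi_obj) (f :: nat \<Rightarrow> 'a fi_arr).
      (\<forall>i \<in> {1..n}. y i \<in> Obj (OI d) \<and> f i \<in> hom (FI d) S (FObj forget_order (y i))) \<and>
      (\<forall>z \<in> Obj (OI d). \<forall>h \<in> hom (FI d) S (FObj forget_order z).
        \<exists>i \<in> {1..n}. \<exists>g \<in> hom (OI d) (y i) z. h = Comp (FI d) (FArr forget_order g) (f i))"
    by (intro exI[of _ n] exI[of _ ?y] exI[of _ ?f]) blast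
qed


section \<open>Well-orders on the hom-sets\<close>

definition first_diff_less :: "'a set \<Rightarrow> 'a rel \<Rightarrow> ('a \<Rightarrow> nat) \<Rightarrow> ('a \<Rightarrow> nat) \<Rightarrow> bool" where
  "first_diff_less T r v w \<longleftrightarrow>
    (\<exists>t \<in> T. v t < w t \<and> (\<forall>u. (u, t) \<in> r \<longrightarrow> u \<noteq> t \<longrightarrow> v u = w u))"

lemma first_diff_less_irrefl: "\<not> first_diff_less T r v v"
  by (simp add: first_diff_less_def)

text \<open>The earlier of the two positions of first difference is the first difference of
  \<open>v\<close> and \<open>x\<close>.\<close>

lemma first_diff_less_trans:
  assumes "linear_order_on T r" "first_diff_less T r v w" "first_diff_less T r w x"
  shows "first_diff_less T r v x"
proof -
  have r: "trans r" "antisym r" "total_on T r"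
    using assms(1) by (auto simp: order_on_defs)
  obtain t where t: "t \<in> T" "v t < w t" "\<And>u. (u, t) \<in> r \<Longrightarrow> u \<noteq> t \<Longrightarrow> v u = w u"
    using assms(2) by (auto simp: first_diff_less_def)
  obtain t' where t': "t' \<in> T" "w t' < x t'" "\<And>u. (u, t') \<in> r \<Longrightarrow> u \<noteq> t' \<Longrightarrow> w u = x u"
    using assms(3) by (auto simp: first_diff_less_def)
  consider "t = t'" | "(t, t') \<in> r" "t \<noteq> t'" | "(t', t) \<in> r" "t \<noteq> t'"
    using r(3) t(1) t'(1) by (auto simp: total_on_def)
  then show ?thesis
  proof cases
    case 1
    then show ?thesis
      unfolding first_diff_less_def using t t' by (intro bexI[of _ t]) auto
  next
    case 2
    then have "w t = x t"
      using t'(3) by blast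
    moreover have "v u = x u" if "(u, t) \<in> r" "u \<noteq> t" for u
      using t(3)[OF that] t'(3)[of u] that 2 r by (metis antisymD transD)
    ultimately show ?thesis
      unfolding first_diff_less_def using t(1,2) by (intro bexI[of _ t]) auto
  next
    case 3
    then have "v t' = w t'"
      using t(3) by simp
    moreover have "v u = x u" if "(u, t') \<in> r" "u \<noteq> t'" for u
      using t'(3)[OF that] t(3)[of u] that 3 r by (metis antisymD transD)
    ultimately show ?thesis
      unfolding first_diff_less_def using t'(1,2) by (intro bexI[of _ t']) auto
  qed
qed

lemma first_diff_less_total:
  assumes "finite T" "linear_order_on T r" "t \<in> T" "v t \<noteq> w t"
  shows "first_diff_less T r v w \<or> first_diff_less T r w v"
proof -
  have r: "r \<subseteq> T \<times> T"
    using assms(2) by (auto simp: order_on_defs)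
  then have "finite r"
    using assms(1) finite_subset by blast
  \<comment> \<open>A first position of difference exists because the strict part of a finite linear
    order is well-founded.\<close>
  then have "wf (r - Id)"
    using assms(2) linear_order_on_well_order_on well_order_on_def by metis
  then obtain m where m: "m \<in> {t \<in> T. v t \<noteq> w t}"
    and min: "\<And>u. (u, m) \<in> r - Id \<Longrightarrow> u \<notin> {t \<in> T. v t \<noteq> w t}"
    using assms(3,4) wfE_min[of "r - Id" t "{t \<in> T. v t \<noteq> w t}"] by auto
  have "v u = w u" if "(u, m) \<in> r" "u \<noteq> m" for u
    using min[of u] that r by auto
  then show ?thesis
    using m unfolding first_diff_less_def by (metis (mono_tags, lifting) mem_Collect_eq linorder_neqE_nat)
qed

text \<open>The coding \<open>e\<close> is fixed while \<open>Y\<close> varies, since compatibility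
  relates the orders on different hom-sets out of \<open>X\<close>.\<close>

definition arrow_order :: "nat \<Rightarrow> ('a \<Rightarrow> nat) \<Rightarrow> 'a oi_obj \<Rightarrow> 'a oi_obj \<Rightarrow> 'a oi_arr rel" where
  "arrow_order d e X Y = {(a, b). a \<in> hom (OI d) X Y \<and> b \<in> hom (OI d) X Y \<and>
    (a = b \<or> first_diff_less (fst Y) (snd Y) (letter d e (fst X) (pair a)) (letter d e (fst X) (pair b)))}"

lemma finite_hom_OI: "finite (hom (OI d) X Y)"
proof (cases "X \<in> ordered_finite_sets \<and> Y \<in> ordered_finite_sets")
  case True
  have "hom (OI d) X Y \<subseteq> Arrow X Y ` coloured_injections d (fst X) (fst Y)"
    by (auto simp: hom_OI_iff)
  then show ?thesis
    using True by (meson finite_coloured_injections finite_imageI finite_subset ordered_finite_setsD(1))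
next
  case False
  then have "hom (OI d) X Y = {}"
    by (auto simp: hom_OI_iff)
  then show ?thesis
    by simp
qed

lemma well_order_on_arrow_order:
  assumes "inj_on e (fst X)" "Y \<in> ordered_finite_sets"
  shows "well_order_on (hom (OI d) X Y) (arrow_order d e X Y)"
proof -
  note Y = ordered_finite_setsD[OF assms(2)]
  let ?R = "arrow_order d e X Y" and ?H = "hom (OI d) X Y"
  have sub: "?R \<subseteq> ?H \<times> ?H"
    by (auto simp: arrow_order_def)
  have "refl_on ?H ?R"
    by (auto simp: arrow_order_def refl_on_def)
  moreover have "trans ?R"
    using first_diff_less_trans[OF Y(2)] unfolding trans_def arrow_order_def by blast
  moreover have "antisym ?R"
  proof (rule antisymI, rule ccontr)
    fix a b assume "(a, b) \<in> ?R" "(b, a) \<in> ?R" "a \<noteq> b"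
    then have "first_diff_less (fst Y) (snd Y) (letter d e (fst X) (pair a)) (letter d e (fst X) (pair a))"
      using first_diff_less_trans[OF Y(2)] unfolding arrow_order_def by blast
    then show False
      using first_diff_less_irrefl by blast
  qed
  moreover have "total_on ?H ?R"
  proof (rule total_onI)
    fix a b assume ab: "a \<in> ?H" "b \<in> ?H" "a \<noteq> b"
    then obtain p p' where "a = Arrow X Y p" "p \<in> coloured_injections d (fst X) (fst Y)"
      "b = Arrow X Y p'" "p' \<in> coloured_injections d (fst X) (fst Y)"
      unfolding hom_OI_iff by blast
    then obtain t where "t \<in> fst Y" "letter d e (fst X) (pair a) t \<noteq> letter d e (fst X) (pair b) t"
      using letter_inject[OF _ _ assms(1), of p d "fst Y" p'] ab(3) by auto
    then show "(a, b) \<in> ?R \<or> (b, a) \<in> ?R"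
      using first_diff_less_total[OF Y(1,2)] ab unfolding arrow_order_def by blast
  qed
  ultimately have "linear_order_on ?H ?R"
    using sub by (simp add: order_on_defs)
  then show ?thesis
    using linear_order_on_well_order_on finite_subset[OF sub] finite_hom_OI
    by (metis finite_SigmaI)
qed

lemma first_diff_less_compose:
  assumes p: "p \<in> coloured_injections d S (fst Y)" and p': "p' \<in> coloured_injections d S (fst Y)"
    and q: "q \<in> coloured_injections d (fst Y) (fst Z)" and "order_preserving Y Z (fst q)"
    and Y: "Y \<in> ordered_finite_sets" and Z: "Z \<in> ordered_finite_sets"
    and less: "first_diff_less (fst Y) (snd Y) (letter d e S p) (letter d e S p')"
  shows "first_diff_less (fst Z) (snd Z)
    (letter d e S (compose_coloured S (fst Y) (fst Z) q p))
    (letter d e S (compose_coloured S (fst Y) (fst Z) q p'))"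
proof -
  note Yo = ordered_finite_setsD[OF Y] and Zo = ordered_finite_setsD[OF Z]
  note qD = coloured_injectionsD[OF q]
  obtain t where t: "t \<in> fst Y" "letter d e S p t < letter d e S p' t"
    "\<And>u. (u, t) \<in> snd Y \<Longrightarrow> u \<noteq> t \<Longrightarrow> letter d e S p u = letter d e S p' u"
    using less by (auto simp: first_diff_less_def)
  show ?thesis
    unfolding first_diff_less_def
  proof (intro bexI[of _ "fst q t"] conjI allI impI)
    show "fst q t \<in> fst Z"
      using qD(4) t(1) .
    show "letter d e S (compose_coloured S (fst Y) (fst Z) q p) (fst q t)
        < letter d e S (compose_coloured S (fst Y) (fst Z) q p') (fst q t)"
      using t letter_compose_image[OF p q t(1)] letter_compose_image[OF p' q t(1)] by simp
    fix z assume z: "(z, fst q t) \<in> snd Z" "z \<noteq> fst q t"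
    show "letter d e S (compose_coloured S (fst Y) (fst Z) q p) z =
        letter d e S (compose_coloured S (fst Y) (fst Z) q p') z"
    proof (cases "z \<in> fst q ` fst Y")
      case True
      then obtain u where u: "u \<in> fst Y" "z = fst q u"
        by blast
      \<comment> \<open>Otherwise \<open>fst q\<close> would put \<open>fst q t\<close> below
        \<open>z\<close>, against antisymmetry in \<open>Z\<close>. Totality in \<open>Y\<close>
        then places \<open>u\<close> strictly before \<open>t\<close>, where the two words
        agree.\<close>
      have "(t, u) \<notin> snd Y"
        using assms(4) z u(2) Zo(5) by (auto simp: order_preserving_def dest: antisymD)
      then have "(u, t) \<in> snd Y" "u \<noteq> t"
        using Yo(6) u t(1) z(2) by (auto simp: total_on_def)
      then show ?thesis
        using t(3) u letter_compose_image[OF p q u(1)] letter_compose_image[OF p' q u(1)] by simp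
    next
      case False
      moreover have "z \<in> fst Z"
        using z(1) Zo(3) by auto
      ultimately show ?thesis
        by (simp add: letter_compose_outside[OF p] letter_compose_outside[OF p'])
    qed
  qed
qed

lemma compatible_well_orders_OI:
  assumes "inj_on e (fst X)"
  shows "compatible_well_orders (OI d) X (arrow_order d e X)"
  unfolding compatible_well_orders_def
proof (intro conjI ballI impI; (elim conjE)?)
  show "well_order_on (hom (OI d) X Y) (arrow_order d e X Y)" if "Y \<in> Obj (OI d)" for Y
    using that well_order_on_arrow_order[OF assms] by (simp add: OI_simps)
next
  fix Y Z :: "'a oi_obj" and c a b
  assume c: "c \<in> hom (OI d) Y Z" and a: "a \<in> hom (OI d) X Y" and b: "b \<in> hom (OI d) X Y"
    and R: "(a, b) \<in> arrow_order d e X Y" and "a \<noteq> b"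
  let ?less = "\<lambda>Y a b. first_diff_less (fst Y) (snd Y)
    (letter d e (fst X) (pair a)) (letter d e (fst X) (pair b))"
  have "?less Y a b"
    using R \<open>a \<noteq> b\<close> by (simp add: arrow_order_def)
  then have less: "?less Z (Comp (OI d) c a) (Comp (OI d) c b)"
  proof -
    obtain p p' q where "a = Arrow X Y p" "b = Arrow X Y p'" "c = Arrow Y Z q"
      using a b c unfolding hom_OI_iff by blast
    then show ?thesis
      using a b c \<open>?less Y a b\<close> by (simp add: hom_OI_iff OI_simps first_diff_less_compose)
  qed
  then show "(Comp (OI d) c a, Comp (OI d) c b) \<in> arrow_order d e X Z"
    using category.comp_closed[OF category_OI a c] category.comp_closed[OF category_OI b c]
    by (simp add: arrow_order_def)
  show "Comp (OI d) c a \<noteq> Comp (OI d) c b"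
    using less first_diff_less_irrefl by metis
qed


section \<open>Noetherianity\<close>

text \<open>Listing both targets in increasing order turns a subword embedding into a strictly
  increasing, letter-preserving map of positions, and such a map underlies a factorisation in
  \<open>OI d\<close>.\<close>

lemma arrow_le_of_subseq:
  assumes p: "p \<in> coloured_injections d (fst X) (fst Y)"
    and p': "p' \<in> coloured_injections d (fst X) (fst Z)"
    and e: "inj_on e (fst X)"
    and Y: "Y \<in> ordered_finite_sets" and Z: "Z \<in> ordered_finite_sets"
    and ys: "set ys = fst Y" "sorted_wrt (\<lambda>a b. (a, b) \<in> snd Y - Id) ys"
    and zs: "set zs = fst Z" "sorted_wrt (\<lambda>a b. (a, b) \<in> snd Z - Id) zs"
    and sub: "subseq (map (letter d e (fst X) p) ys) (map (letter d e (fst X) p') zs)"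
  shows "arrow_le (OI d) (Arrow X Y p) (Arrow X Z p')"
proof -
  note Yo = ordered_finite_setsD[OF Y] and Zo = ordered_finite_setsD[OF Z]
  have "distinct ys"
    using ys(2) by (induction ys) auto
  then obtain h where h: "subseq (map h ys) zs"
    "\<And>t. t \<in> fst Y \<Longrightarrow> letter d e (fst X) p' (h t) = letter d e (fst X) p t"
    using subseq_map_obtain[OF sub] ys(1) by auto
  have hset: "h ` fst Y \<subseteq> fst Z"
    using list_emb_set[OF h(1)] ys(1) zs(1) by auto
  \<comment> \<open>\<open>map h ys\<close> is a subsequence of the sorted list \<open>zs\<close>,
    hence sorted; antisymmetry in \<open>Y\<close> excludes that \<open>b\<close> is listed before
    \<open>a\<close>.\<close>
  have mono: "(h a, h b) \<in> snd Z - Id" if "(a, b) \<in> snd Y" "a \<noteq> b" for a b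
    using that Yo(3,5) ys(1) antisymD
    by (intro sorted_wrt_map_in_order[OF ys(2) sorted_wrt_subseq[OF h(1) zs(2)]])
      (auto dest: antisymD)
  have "inj_on h (fst Y)"
  proof (rule inj_onI, rule ccontr)
    fix a b assume "a \<in> fst Y" "b \<in> fst Y" "h a = h b" "a \<noteq> b"
    then show False
      using mono[of a b] mono[of b a] Yo(6) by (auto simp: total_on_def)
  qed
  then obtain q where q: "q \<in> coloured_injections d (fst Y) (fst Z)"
    "fst q = restrict h (fst Y)" "p' = compose_coloured (fst X) (fst Y) (fst Z) q p"
    using coloured_injection_factors[OF p p' e _ hset h(2)] by blast
  have "order_preserving Y Z (fst q)"
    unfolding order_preserving_def
  proof clarify
    fix a b assume ab: "(a, b) \<in> snd Y"
    then have "a \<in> fst Y" "b \<in> fst Y"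
      using Yo(3) by auto
    then show "(fst q a, fst q b) \<in> snd Z"
      using ab mono[of a b] hset Zo(7) q(2) by (cases "a = b") (auto simp: refl_on_def)
  qed
  then have "Arrow Y Z q \<in> hom (OI d) Y Z"
    using q(1) Y Z by (simp add: hom_OI_iff)
  moreover have "Cod (OI d) (Arrow X Y p) = Y" "Cod (OI d) (Arrow X Z p') = Z"
    by (simp_all add: OI_def)
  ultimately show ?thesis
    unfolding arrow_le_def q(3) by (intro bexI[of _ "Arrow Y Z q"]) (simp_all only: OI_simps(3))
qed

lemma noetherian_OI:
  assumes "X \<in> Obj (OI d)"
  shows "noetherian_poset (arrow_classes (OI d) X) (class_le (OI d))"
  unfolding noetherian_poset_def
proof (intro allI impI)
  fix s :: "nat \<Rightarrow> 'a oi_arr set"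
  assume s: "\<forall>i. s i \<in> arrow_classes (OI d) X"
  \<comment> \<open>\<open>class_le\<close> asks only for some representatives, so one arrow per
    class suffices; the arrow generating a class lies in it because identities make
    \<open>arrow_le\<close> reflexive.\<close>
  have "\<exists>Y p. Arrow X Y p \<in> s i \<and> Arrow X Y p \<in> hom (OI d) X Y" for i
  proof -
    obtain a where a: "a \<in> arrows_from (OI d) X" "s i = arrow_equiv (OI d) X `` {a}"
      using s unfolding arrow_classes_def by (meson quotientE)
    then have hom: "a \<in> hom (OI d) X (Cod (OI d) a)"
      by (simp add: arrows_from_def hom_def)
    interpret category "OI d :: ('a oi_obj, 'a oi_arr) cat"
      by (rule category_OI)
    have "Cod (OI d) a \<in> Obj (OI d)"
      using a(1) cod_closed by (simp add: arrows_from_def)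
    then have "arrow_le (OI d) a a"
      unfolding arrow_le_def using ident_closed comp_ident_left[OF hom] by metis
    then have "a \<in> s i"
      using a by (simp add: arrow_equiv_def)
    then show ?thesis
      using hom by (metis hom_OI_iff)
  qed
  then obtain Y p where a: "\<And>i. Arrow X (Y i) (p i) \<in> s i"
    and hom: "\<And>i. Arrow X (Y i) (p i) \<in> hom (OI d) X (Y i)"
    by metis
  have p: "p i \<in> coloured_injections d (fst X) (fst (Y i))" and Y: "Y i \<in> ordered_finite_sets" for i
    using hom[of i] by (auto simp: hom_OI_iff)
  have X: "finite (fst X)"
    using assms ordered_finite_setsD(1) by (simp add: OI_simps)
  \<comment> \<open>One coding chosen from \<open>X\<close> alone, before the targets
    \<open>Y i\<close> enter, so that all words share one finite alphabet.\<close>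
  then obtain e :: "'a \<Rightarrow> nat" where e: "inj_on e (fst X)"
    using finite_imp_inj_to_nat_seg by metis
  have "\<forall>i. \<exists>xs. set xs = fst (Y i) \<and> sorted_wrt (\<lambda>a b. (a, b) \<in> snd (Y i) - Id) xs"
    using finite_linear_order_list ordered_finite_setsD(1,2)[OF Y] by blast
  then obtain xs where xs: "\<And>i. set (xs i) = fst (Y i)"
    "\<And>i. sorted_wrt (\<lambda>a b. (a, b) \<in> snd (Y i) - Id) (xs i)"
    by metis
  let ?w = "\<lambda>i. map (letter d e (fst X) (p i)) (xs i)"
  let ?A = "{..d} \<union> (\<lambda>s. Suc d + e s) ` fst X"
  have "?w i \<in> lists ?A" for i
    using letter_mem_alphabet[OF p] xs(1) by (auto simp only: in_lists_conv_set set_map)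
  moreover have "subseq_wqo (lists ?A)"
    using X by (intro higman_finite_alphabet) simp
  ultimately obtain \<phi> :: "nat \<Rightarrow> nat"
    where \<phi>: "strict_mono \<phi>" "\<And>i j. i \<le> j \<Longrightarrow> subseq (?w (\<phi> i)) (?w (\<phi> j))"
    using subseq_wqoD[of "lists ?A" ?w] by metis
  have "arrow_le (OI d) (Arrow X (Y (\<phi> 0)) (p (\<phi> 0))) (Arrow X (Y (\<phi> 1)) (p (\<phi> 1)))"
    by (rule arrow_le_of_subseq[OF p p e Y Y xs xs]) (simp add: \<phi>(2))
  then have "class_le (OI d) (s (\<phi> 0)) (s (\<phi> 1))"
    unfolding class_le_def using a by blast
  moreover have "\<phi> 0 < \<phi> 1"
    using \<phi>(1) by (simp add: strict_mono_def)
  ultimately show "\<exists>i j. i < j \<and> class_le (OI d) (s i) (s j)"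
    by blast
qed

lemma groebner_OI: "groebner (OI d)"
  unfolding groebner_def
proof (intro conjI ballI category_OI noetherian_OI)
  fix X :: "'a oi_obj"
  assume "X \<in> Obj (OI d)"
  then have "finite (fst X)"
    using ordered_finite_setsD(1) by (simp add: OI_simps)
  then obtain e :: "'a \<Rightarrow> nat" where "inj_on e (fst X)"
    using finite_imp_inj_to_nat_seg by metis
  then show "\<exists>R. compatible_well_orders (OI d) X R"
    using compatible_well_orders_OI by blast
qed

theorem theorem7p1p4:
  fixes d :: nat
  assumes "d \<ge> 1"
  shows "property_F (OI d :: ('a oi_obj, 'a oi_arr) cat) (FI d) forget_order \<and>
    quasi_groebner TYPE('a oi_obj \<times> 'a oi_arr) (FI d :: ('a fi_obj, 'a fi_arr) cat)"
  unfolding quasi_groebner_def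
  using forget_order_property_F groebner_OI forget_order_essentially_surjective by blast

end
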